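(* Let $d\ge2$ and $p_1,\dots,p_d\in\mathbb{TP}^d$ be arbitrary points (not necessarily in general position). Then the set $\{x\in\mathbb{TP}^d:\tau_{p_1,\dots,p_d}(x)=1\}$ is either empty or the union of at most $d$ open sectors of a single tropical hyperplane. Conversely, for every tropical hyperplane $\mathcal H$ and every union $U$ of at least one and at most $d$ open sectors of $\mathcal H$, there exist points $p_1,\dots,p_d\in\mathbb{TP}^d$ with $\{x\in\mathbb{TP}^d:\tau_{p_1,\dots,p_d}(x)=1\}=U$.
   Context: $\mathbb{TP}^d=\mathbb R^{d+1}/\mathbb R(1,\dots,1)$, points written via representatives $(\xi_0,\dots,\xi_d)$. For $c=(\gamma_0,\dots,\gamma_d)\in\mathbb{TP}^d$, the tropical hyperplane with apex $c$ is the set of $x$ such that $\min_i(\xi_i-\gamma_i)$ is attained at least twice; its open sectors are the $d+1$ sets $c+S_k$, $k=0,\dots,d$, where $S_k=\{(\xi_0,\dots,\xi_d):\xi_k<\xi_j\text{ for all }j\ne k\}$. For a real matrix $M=(m_{ij})_{i,j=0}^d$ the tropical determinant is $\mathrm{tdet}\,M=\min_{\sigma\in\mathrm{Sym}(d+1)}(m_{0,\sigma(0)}+\dots+m_{d,\sigma(d)})$; $M$ is tropically singular if this minimum is attained by at least two permutations, otherwise tropically regular. The tropical sign $\mathrm{tsgn}\,M$ is $0$ if $M$ is tropically singular, and otherwise the sign of the unique minimizing permutation. Adding a constant to a row does not change $\mathrm{tsgn}$, so for $x,p_1,\dots,p_d\in\mathbb{TP}^d$ the value $\tau_{p_1,\dots,p_d}(x)=\mathrm{tsgn}(x,p_1,\dots,p_d)\in\{-1,0,1\}$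 (matrix with rows representatives of $x,p_1,\dots,p_d$, in this order) is well defined. *)

theory Defs
  imports Complex_Main "HOL-Library.FuncSet" "HOL-Combinatorics.Permutations"
begin

section \<open>The tropical projective torus\<close>

text \<open>
  Vectors of length \<open>d + 1\<close> are extensional functions on \<open>{..d}\<close>; the points of
  \<open>TP d\<close> are the classes of such vectors modulo real multiples of \<open>(1, \<dots>, 1)\<close>.
\<close>

definition tp_vecs :: "nat \<Rightarrow> (nat \<Rightarrow> real) set" where
  "tp_vecs d = {..d} \<rightarrow>\<^sub>E UNIV"

definition tp_rel :: "nat \<Rightarrow> ((nat \<Rightarrow> real) \<times> (nat \<Rightarrow> real)) set" where
  "tp_rel d = {(\<xi>, \<eta>). \<xi> \<in> tp_vecs d \<and> \<eta> \<in> tp_vecs d \<and> (\<exists>t. \<forall>i\<le>d. \<eta> i = \<xi> i + t)}"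

type_synonym tp_point = "(nat \<Rightarrow> real) set"

definition TP :: "nat \<Rightarrow> tp_point set" where
  "TP d = tp_vecs d // tp_rel d"

text \<open>
  A choice of representative. All notions below that use it are independent of the
  choice; see the lemmas \<open>S_sector_iff\<close>, \<open>tp_add_eq\<close>, \<open>trop_hyperplane_iff\<close> and \<open>tau_eq\<close>.
\<close>

definition tp_rep :: "tp_point \<Rightarrow> nat \<Rightarrow> real" where
  "tp_rep X = (SOME \<xi>. \<xi> \<in> X)"

definition tp_add :: "nat \<Rightarrow> tp_point \<Rightarrow> tp_point \<Rightarrow> tp_point" where
  "tp_add d X Y = tp_rel d `` {\<lambda>i\<in>{..d}. tp_rep X i + tp_rep Y i}"

section \<open>Tropical hyperplanes and their open sectors\<close>

definition min_attained_twice :: "nat \<Rightarrow> (nat \<Rightarrow> real) \<Rightarrow> bool" where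
  "min_attained_twice d v \<longleftrightarrow>
     (\<exists>i\<le>d. \<exists>j\<le>d. i \<noteq> j \<and> v i = Min (v ` {..d}) \<and> v j = Min (v ` {..d}))"

definition trop_hyperplane :: "nat \<Rightarrow> tp_point \<Rightarrow> tp_point set" where
  "trop_hyperplane d c = {X \<in> TP d. min_attained_twice d (\<lambda>i. tp_rep X i - tp_rep c i)}"

definition trop_hyperplanes :: "nat \<Rightarrow> tp_point set set" where
  "trop_hyperplanes d = trop_hyperplane d ` TP d"

definition S_sector :: "nat \<Rightarrow> nat \<Rightarrow> tp_point set" where
  "S_sector d k = {X \<in> TP d. \<forall>j\<le>d. j \<noteq> k \<longrightarrow> tp_rep X k < tp_rep X j}"

definition open_sector :: "nat \<Rightarrow> tp_point \<Rightarrow> nat \<Rightarrow> tp_point set" where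
  "open_sector d c k = tp_add d c ` S_sector d k"

definition open_sectors :: "nat \<Rightarrow> tp_point set \<Rightarrow> tp_point set set" where
  "open_sectors d H = {open_sector d c k | c k. c \<in> TP d \<and> H = trop_hyperplane d c \<and> k \<le> d}"

section \<open>Tropical determinant and tropical sign\<close>

text \<open>
  An \<open>M :: nat \<Rightarrow> nat \<Rightarrow> real\<close> stands for the square matrix with rows and columns
  indexed by \<open>{..d}\<close>; other entries are irrelevant.
\<close>

definition perm_weight :: "nat \<Rightarrow> (nat \<Rightarrow> nat \<Rightarrow> real) \<Rightarrow> (nat \<Rightarrow> nat) \<Rightarrow> real" where
  "perm_weight d M \<sigma> = (\<Sum>i\<le>d. M i (\<sigma> i))"

definition tdet :: "nat \<Rightarrow> (nat \<Rightarrow> nat \<Rightarrow> real) \<Rightarrow> real" where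
  "tdet d M = Min (perm_weight d M ` {\<sigma>. \<sigma> permutes {..d}})"

definition minimizing_perm :: "nat \<Rightarrow> (nat \<Rightarrow> nat \<Rightarrow> real) \<Rightarrow> (nat \<Rightarrow> nat) \<Rightarrow> bool" where
  "minimizing_perm d M \<sigma> \<longleftrightarrow> \<sigma> permutes {..d} \<and> perm_weight d M \<sigma> = tdet d M"

definition trop_singular :: "nat \<Rightarrow> (nat \<Rightarrow> nat \<Rightarrow> real) \<Rightarrow> bool" where
  "trop_singular d M \<longleftrightarrow>
     (\<exists>\<sigma> \<sigma>'. \<sigma> \<noteq> \<sigma>' \<and> minimizing_perm d M \<sigma> \<and> minimizing_perm d M \<sigma>')"

definition tsgn :: "nat \<Rightarrow> (nat \<Rightarrow> nat \<Rightarrow> real) \<Rightarrow> int" where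
  "tsgn d M = (if trop_singular d M then 0 else sign (THE \<sigma>. minimizing_perm d M \<sigma>))"

text \<open>Row \<open>0\<close> is the argument \<open>X\<close>, and row \<open>i\<close> is \<open>p i\<close> for \<open>i = 1, \<dots>, d\<close>.\<close>

definition tau :: "nat \<Rightarrow> (nat \<Rightarrow> tp_point) \<Rightarrow> tp_point \<Rightarrow> int" where
  "tau d p X = tsgn d (\<lambda>i. tp_rep (if i = 0 then X else p i))"

section \<open>Independence of representatives\<close>

lemma equiv_tp_rel: "equiv (tp_vecs d) (tp_rel d)"
proof (rule equivI)
  show "tp_rel d \<subseteq> tp_vecs d \<times> tp_vecs d" by (auto simp: tp_rel_def)
  show "refl_on (tp_vecs d) (tp_rel d)"
    by (auto simp: refl_on_def tp_rel_def intro: exI[of _ 0])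
  show "sym (tp_rel d)"
  proof (rule symI)
    fix x y assume "(x, y) \<in> tp_rel d"
    then obtain t where "x \<in> tp_vecs d" "y \<in> tp_vecs d" "\<forall>i\<le>d. y i = x i + t"
      by (auto simp: tp_rel_def)
    then show "(y, x) \<in> tp_rel d" by (auto simp: tp_rel_def intro!: exI[of _ "-t"])
  qed
  show "trans (tp_rel d)"
  proof (rule transI)
    fix x y z assume "(x, y) \<in> tp_rel d" "(y, z) \<in> tp_rel d"
    then have xz: "x \<in> tp_vecs d" "z \<in> tp_vecs d"
      and "\<exists>t. \<forall>i\<le>d. y i = x i + t" "\<exists>u. \<forall>i\<le>d. z i = y i + u"
      by (simp_all add: tp_rel_def)
    then obtain t u where "\<forall>i\<le>d. y i = x i + t" "\<forall>i\<le>d. z i = y i + u" by blast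
    with xz show "(x, z) \<in> tp_rel d" by (auto simp: tp_rel_def intro!: exI[of _ "t + u"])
  qed
qed

lemma tp_rep_in: "X \<in> TP d \<Longrightarrow> tp_rep X \<in> X"
  unfolding tp_rep_def TP_def
  by (metis equiv_tp_rel in_quotient_imp_non_empty ex_in_conv someI_ex)

lemma tp_rep_shift:
  assumes "X \<in> TP d" "\<xi> \<in> X"
  obtains t where "\<And>i. i \<le> d \<Longrightarrow> tp_rep X i = \<xi> i + t"
proof -
  have "(\<xi>, tp_rep X) \<in> tp_rel d"
    using quotient_eq_iff[OF equiv_tp_rel, of X d X \<xi> "tp_rep X"] assms tp_rep_in[OF assms(1)]
    by (simp add: TP_def)
  then show ?thesis using that by (auto simp: tp_rel_def)
qed

lemma S_sector_iff:
  assumes "X \<in> TP d" "\<xi> \<in> X" "k \<le> d"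
  shows "X \<in> S_sector d k \<longleftrightarrow> (\<forall>j\<le>d. j \<noteq> k \<longrightarrow> \<xi> k < \<xi> j)"
proof -
  obtain t where "\<And>i. i \<le> d \<Longrightarrow> tp_rep X i = \<xi> i + t" using tp_rep_shift[OF assms(1,2)] by blast
  with assms show ?thesis by (auto simp: S_sector_def)
qed

lemma tp_add_eq:
  assumes "X \<in> TP d" "\<xi> \<in> X" "Y \<in> TP d" "\<eta> \<in> Y"
  shows "tp_add d X Y = tp_rel d `` {\<lambda>i\<in>{..d}. \<xi> i + \<eta> i}"
proof -
  obtain t where t: "\<And>i. i \<le> d \<Longrightarrow> tp_rep X i = \<xi> i + t" using tp_rep_shift[OF assms(1,2)] by blast
  obtain u where u: "\<And>i. i \<le> d \<Longrightarrow> tp_rep Y i = \<eta> i + u" using tp_rep_shift[OF assms(3,4)] by blast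
  show ?thesis unfolding tp_add_def
    by (rule equiv_class_eq[OF equiv_tp_rel])
       (auto simp: tp_rel_def tp_vecs_def t u intro!: exI[of _ "- t - u"])
qed

lemma min_attained_twice_iff:
  "min_attained_twice d v \<longleftrightarrow> (\<exists>i\<le>d. \<exists>j\<le>d. i \<noteq> j \<and> v i = v j \<and> (\<forall>l\<le>d. v i \<le> v l))"
proof -
  have "v i = Min (v ` {..d}) \<longleftrightarrow> (\<forall>l\<le>d. v i \<le> v l)" if "i \<le> d" for i
    using that by (subst eq_commute, subst Min_eq_iff) auto
  moreover have pair: "(\<forall>l\<le>d. v i \<le> v l) \<and> (\<forall>l\<le>d. v j \<le> v l) \<longleftrightarrow> v i = v j \<and> (\<forall>l\<le>d. v i \<le> v l)"
    if "i \<le> d" "j \<le> d" for i j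
    using that by (auto intro: order_antisym)
  ultimately have "min_attained_twice d v \<longleftrightarrow>
      (\<exists>i\<le>d. \<exists>j\<le>d. i \<noteq> j \<and> (\<forall>l\<le>d. v i \<le> v l) \<and> (\<forall>l\<le>d. v j \<le> v l))"
    unfolding min_attained_twice_def by (simp cong: conj_cong)
  also have "\<dots> \<longleftrightarrow> (\<exists>i\<le>d. \<exists>j\<le>d. i \<noteq> j \<and> v i = v j \<and> (\<forall>l\<le>d. v i \<le> v l))"
    using pair by (simp cong: conj_cong)
  finally show ?thesis .
qed

lemma trop_hyperplane_iff:
  assumes "X \<in> TP d" "\<xi> \<in> X" "c \<in> TP d" "\<gamma> \<in> c"
  shows "X \<in> trop_hyperplane d c \<longleftrightarrow> min_attained_twice d (\<lambda>i. \<xi> i - \<gamma> i)"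
proof -
  obtain t where t: "\<And>i. i \<le> d \<Longrightarrow> tp_rep X i = \<xi> i + t" using tp_rep_shift[OF assms(1,2)] by blast
  obtain u where u: "\<And>i. i \<le> d \<Longrightarrow> tp_rep c i = \<gamma> i + u" using tp_rep_shift[OF assms(3,4)] by blast
  have eq: "tp_rep X i - tp_rep c i = (\<xi> i - \<gamma> i) + (t - u)" if "i \<le> d" for i
    using that by (simp add: t u)
  show ?thesis using assms(1)
    by (simp add: trop_hyperplane_def min_attained_twice_iff eq cong: conj_cong)
qed

lemma tsgn_row_shift:
  assumes "\<And>i j. i \<le> d \<Longrightarrow> j \<le> d \<Longrightarrow> M' i j = M i j + t i"
  shows "tsgn d M' = tsgn d M"
proof -
  define T where "T = (\<Sum>i\<le>d. t i)"
  have w: "perm_weight d M' \<sigma> = perm_weight d M \<sigma> + T" if "\<sigma> permutes {..d}" for \<sigma>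
  proof -
    have "\<And>i. i \<le> d \<Longrightarrow> \<sigma> i \<le> d" using permutes_in_image[OF that] by auto
    then show ?thesis
      unfolding perm_weight_def T_def sum.distrib[symmetric] by (intro sum.cong) (auto simp: assms)
  qed
  have fin: "finite {\<sigma>. \<sigma> permutes {..d}}" by (simp add: finite_permutations)
  have ne: "{\<sigma>. \<sigma> permutes {..d}} \<noteq> {}" using permutes_id by blast
  have "perm_weight d M' ` {\<sigma>. \<sigma> permutes {..d}} =
        (\<lambda>\<sigma>. perm_weight d M \<sigma> + T) ` {\<sigma>. \<sigma> permutes {..d}}"
    using w by (intro image_cong) auto
  then have "tdet d M' = tdet d M + T"
    unfolding tdet_def using Min_add_commute[OF fin ne] by simp
  then have "minimizing_perm d M' = minimizing_perm d M"
    by (auto simp: minimizing_perm_def w fun_eq_iff)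
  then show ?thesis unfolding tsgn_def trop_singular_def by (simp only:)
qed

lemma tau_eq:
  assumes "X \<in> TP d" "\<xi> \<in> X" "\<And>i. 1 \<le> i \<Longrightarrow> i \<le> d \<Longrightarrow> p i \<in> TP d \<and> \<pi> i \<in> p i"
  shows "tau d p X = tsgn d (\<lambda>i. if i = 0 then \<xi> else \<pi> i)"
proof -
  have "\<exists>t. \<forall>j\<le>d. tp_rep (if i = 0 then X else p i) j = (if i = 0 then \<xi> else \<pi> i) j + t"
    if "i \<le> d" for i
  proof (cases "i = 0")
    case True
    then show ?thesis using tp_rep_shift[OF assms(1,2)] by metis
  next
    case False
    then have "p i \<in> TP d" "\<pi> i \<in> p i" using assms(3)[of i] that by auto
    then show ?thesis using False by (metis tp_rep_shift)
  qed
  then obtain t where "\<And>i j. i \<le> d \<Longrightarrow> j \<le> d \<Longrightarrow>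
      tp_rep (if i = 0 then X else p i) j = (if i = 0 then \<xi> else \<pi> i) j + t i"
    by metis
  then show ?thesis unfolding tau_def by (rule tsgn_row_shift)
qed

end

theory Submission
  imports Defs
begin

text \<open>
  Expanding along the row of \<open>x\<close>, the weight of a permutation \<open>\<sigma>\<close> with \<open>\<sigma> 0 = k\<close> is \<open>x k\<close>
  plus the cost of a matching of the remaining rows with the columns other than \<open>k\<close>. If
  \<open>c k\<close> is the least such cost, then \<open>\<tau>\<close> vanishes on the hyperplane with apex \<open>-c\<close> and is
  constant on each of its open sectors, where it is the sign \<open>\<epsilon> k\<close> of the \<open>k\<close>-th minor. Not
  all \<open>\<epsilon> k\<close> are \<open>1\<close>: for \<open>x = p 1\<close>, composing a minimizing permutation with the transposition
  of the rows \<open>0\<close> and \<open>1\<close> gives another one, of opposite sign.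

  Conversely, take a tree on the columns which is bipartite with colour classes \<open>K\<close> and its
  complement, and for each edge a row which is \<open>0\<close> at its two ends and \<open>1\<close> elsewhere. The
  unique optimal matching that omits \<open>k\<close> sends each edge to its end away from \<open>k\<close>, and moving
  \<open>k\<close> along an edge composes it with a transposition, so that \<open>\<epsilon>\<close> is constant on each of the
  two colour classes, with opposite values.
\<close>

section \<open>Strictly minimizing permutations\<close>

text \<open>A minimizer is unique exactly when every other permutation is strictly heavier. This
  form replaces \<open>Min\<close> and \<open>THE\<close> by strict inequalities, which can be
  sorted by the value at \<open>0\<close>.\<close>

lemma tsgn_eq_1_iff:
  "tsgn d M = 1 \<longleftrightarrow> (\<exists>\<sigma>. \<sigma> permutes {..d} \<and> sign \<sigma> = 1 \<and>
     (\<forall>\<tau>. \<tau> permutes {..d} \<and> \<tau> \<noteq> \<sigma> \<longrightarrow> perm_weight d M \<sigma> < perm_weight d M \<tau>))"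
    (is "?L \<longleftrightarrow> ?R")
proof -
  let ?P = "{\<sigma>. \<sigma> permutes {..d}}"
  have fin: "finite ?P" by (simp add: finite_permutations)
  have ne: "?P \<noteq> {}" using permutes_id by blast
  have mini: "minimizing_perm d M \<sigma> \<longleftrightarrow> \<sigma> permutes {..d} \<and>
      (\<forall>\<tau>. \<tau> permutes {..d} \<longrightarrow> perm_weight d M \<sigma> \<le> perm_weight d M \<tau>)" for \<sigma>
  proof (cases "\<sigma> permutes {..d}")
    case True
    then have "perm_weight d M \<sigma> = tdet d M \<longleftrightarrow>
        (\<forall>\<tau>. \<tau> permutes {..d} \<longrightarrow> perm_weight d M \<sigma> \<le> perm_weight d M \<tau>)"
      unfolding tdet_def using fin by (subst eq_commute, subst Min_eq_iff) auto
    with True show ?thesis by (simp add: minimizing_perm_def)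
  qed (simp add: minimizing_perm_def)
  have "tdet d M \<in> perm_weight d M ` ?P"
    unfolding tdet_def using fin ne by (intro Min_in) auto
  then obtain \<sigma>0 where \<sigma>0: "minimizing_perm d M \<sigma>0"
    by (auto simp: minimizing_perm_def)
  show ?thesis
  proof
    assume L: ?L
    then have ns: "\<not> trop_singular d M" by (auto simp: tsgn_def split: if_splits)
    then have uniq: "\<And>\<tau>. minimizing_perm d M \<tau> \<Longrightarrow> \<tau> = \<sigma>0"
      using \<sigma>0 by (auto simp: trop_singular_def)
    then have "(THE \<sigma>. minimizing_perm d M \<sigma>) = \<sigma>0" using \<sigma>0 by (intro the_equality)
    then have "sign \<sigma>0 = 1" using L ns by (simp add: tsgn_def)
    moreover have "perm_weight d M \<sigma>0 < perm_weight d M \<tau>"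
      if \<tau>: "\<tau> permutes {..d}" "\<tau> \<noteq> \<sigma>0" for \<tau>
    proof (rule ccontr)
      assume "\<not> ?thesis"
      then have "minimizing_perm d M \<tau>" using \<sigma>0 \<tau>(1) by (force simp: mini)
      then show False using uniq \<tau>(2) by blast
    qed
    ultimately show ?R using \<sigma>0 by (auto simp: mini)
  next
    assume ?R
    then obtain \<sigma> where \<sigma>: "\<sigma> permutes {..d}" "sign \<sigma> = 1"
      "\<And>\<tau>. \<tau> permutes {..d} \<Longrightarrow> \<tau> \<noteq> \<sigma> \<Longrightarrow> perm_weight d M \<sigma> < perm_weight d M \<tau>" by blast
    then have "minimizing_perm d M \<sigma>" by (force simp: mini)
    moreover have "\<tau> = \<sigma>" if "minimizing_perm d M \<tau>" for \<tau>
      using that \<sigma>(1) \<sigma>(3)[of \<tau>] by (force simp: mini)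
    ultimately have "minimizing_perm d M = (\<lambda>\<tau>. \<tau> = \<sigma>)" by blast
    then show ?L using \<sigma>(2) by (simp add: tsgn_def trop_singular_def)
  qed
qed

section \<open>Expansion along the first row\<close>

definition minor_cost :: "nat \<Rightarrow> (nat \<Rightarrow> nat \<Rightarrow> real) \<Rightarrow> (nat \<Rightarrow> nat) \<Rightarrow> real" where
  "minor_cost d \<pi> \<sigma> = (\<Sum>i\<in>{1..d}. \<pi> i (\<sigma> i))"

text \<open>A matching of rows \<open>1..d\<close> with the columns other than \<open>k\<close> is
  encoded as a permutation of all of \<open>{..d}\<close>, which gives it a sign at once.\<close>

definition minor_perms :: "nat \<Rightarrow> nat \<Rightarrow> (nat \<Rightarrow> nat) set" where
  "minor_perms d k = {\<sigma>. \<sigma> permutes {..d} \<and> \<sigma> 0 = k}"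

definition minor_tdet :: "nat \<Rightarrow> (nat \<Rightarrow> nat \<Rightarrow> real) \<Rightarrow> nat \<Rightarrow> real" where
  "minor_tdet d \<pi> k = Min (minor_cost d \<pi> ` minor_perms d k)"

text \<open>
  The sign of a permutation in \<open>minor_perms d k\<close> is the signed cofactor, so the factor
  \<open>(-1) ^ k\<close> is included.
\<close>

definition positive_minors :: "nat \<Rightarrow> (nat \<Rightarrow> nat \<Rightarrow> real) \<Rightarrow> nat set" where
  "positive_minors d \<pi> = {k. k \<le> d \<and> (\<exists>\<sigma>\<in>minor_perms d k. sign \<sigma> = 1 \<and>
     (\<forall>\<tau>\<in>minor_perms d k. \<tau> \<noteq> \<sigma> \<longrightarrow> minor_cost d \<pi> \<sigma> < minor_cost d \<pi> \<tau>))}"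

lemma perm_weight_first_row:
  "perm_weight d (\<lambda>i. if i = 0 then \<xi> else \<pi> i) \<sigma> = \<xi> (\<sigma> 0) + minor_cost d \<pi> \<sigma>"
proof -
  have "{..d} = insert 0 {1..d}" by auto
  then show ?thesis by (simp add: perm_weight_def minor_cost_def)
qed

lemma finite_minor_perms: "finite (minor_perms d k)"
  unfolding minor_perms_def
  by (rule finite_subset[OF _ finite_permutations[of "{..d}"]]) auto

lemma minor_tdet_le: "\<sigma> \<in> minor_perms d k \<Longrightarrow> minor_tdet d \<pi> k \<le> minor_cost d \<pi> \<sigma>"
  unfolding minor_tdet_def by (intro Min_le) (auto simp: finite_minor_perms)

lemma minor_tdet_attained:
  assumes "k \<le> d"
  obtains \<sigma> where "\<sigma> \<in> minor_perms d k" "minor_cost d \<pi> \<sigma> = minor_tdet d \<pi> k"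
proof -
  have "transpose 0 k \<in> minor_perms d k"
    using assms by (auto simp: minor_perms_def intro: permutes_swap_id)
  then have "minor_tdet d \<pi> k \<in> minor_cost d \<pi> ` minor_perms d k"
    unfolding minor_tdet_def by (intro Min_in) (auto simp: finite_minor_perms)
  then show ?thesis using that by auto
qed

text \<open>Permutations are sorted by the column \<open>k\<close> of row \<open>0\<close>. Within a
  class \<open>\<xi> k\<close> is constant, so a strict minimizer is one that wins strictly in its
  class while the minimum of this class beats that of every other class.\<close>

lemma tsgn_first_row_eq_1_iff:
  "tsgn d (\<lambda>i. if i = 0 then \<xi> else \<pi> i) = 1 \<longleftrightarrow>
     (\<exists>k\<in>positive_minors d \<pi>. \<forall>j\<le>d. j \<noteq> k \<longrightarrow>
        \<xi> k + minor_tdet d \<pi> k < \<xi> j + minor_tdet d \<pi> j)" (is "?L \<longleftrightarrow> ?R")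
proof
  assume ?L
  then obtain \<sigma> where \<sigma>: "\<sigma> permutes {..d}" "sign \<sigma> = 1"
    and less: "\<And>\<tau>. \<tau> permutes {..d} \<Longrightarrow> \<tau> \<noteq> \<sigma> \<Longrightarrow>
      \<xi> (\<sigma> 0) + minor_cost d \<pi> \<sigma> < \<xi> (\<tau> 0) + minor_cost d \<pi> \<tau>"
    unfolding tsgn_eq_1_iff perm_weight_first_row by blast
  have k: "\<sigma> 0 \<le> d" using permutes_in_image[OF \<sigma>(1), of 0] by simp
  have \<sigma>m: "\<sigma> \<in> minor_perms d (\<sigma> 0)" using \<sigma>(1) by (simp add: minor_perms_def)
  have "\<sigma> 0 \<in> positive_minors d \<pi>"
    unfolding positive_minors_def using k \<sigma>(2) \<sigma>m less by (force simp: minor_perms_def)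
  moreover have "\<xi> (\<sigma> 0) + minor_tdet d \<pi> (\<sigma> 0) < \<xi> j + minor_tdet d \<pi> j"
    if j: "j \<le> d" "j \<noteq> \<sigma> 0" for j
  proof -
    obtain \<tau> where "\<tau> \<in> minor_perms d j" "minor_cost d \<pi> \<tau> = minor_tdet d \<pi> j"
      using minor_tdet_attained[OF j(1)] by blast
    moreover from this have "\<tau> \<noteq> \<sigma>" using j(2) by (auto simp: minor_perms_def)
    ultimately show ?thesis
      using less[of \<tau>] minor_tdet_le[OF \<sigma>m, of \<pi>] by (simp add: minor_perms_def)
  qed
  ultimately show ?R by blast
next
  assume ?R
  then obtain k \<sigma> where \<sigma>: "\<sigma> \<in> minor_perms d k" "sign \<sigma> = 1" and k: "k \<le> d"
    and less: "\<And>\<tau>. \<tau> \<in> minor_perms d k \<Longrightarrow> \<tau> \<noteq> \<sigma> \<Longrightarrow> minor_cost d \<pi> \<sigma> < minor_cost d \<pi> \<tau>"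
    and min: "\<And>j. j \<le> d \<Longrightarrow> j \<noteq> k \<Longrightarrow> \<xi> k + minor_tdet d \<pi> k < \<xi> j + minor_tdet d \<pi> j"
    unfolding positive_minors_def by blast
  have eq: "minor_tdet d \<pi> k = minor_cost d \<pi> \<sigma>"
  proof -
    obtain \<tau> where "\<tau> \<in> minor_perms d k" "minor_cost d \<pi> \<tau> = minor_tdet d \<pi> k"
      using minor_tdet_attained[OF k] by blast
    then show ?thesis
      using less[of \<tau>] minor_tdet_le[OF \<sigma>(1), of \<pi>] by (cases "\<tau> = \<sigma>") auto
  qed
  have "\<xi> (\<sigma> 0) + minor_cost d \<pi> \<sigma> < \<xi> (\<tau> 0) + minor_cost d \<pi> \<tau>"
    if \<tau>: "\<tau> permutes {..d}" "\<tau> \<noteq> \<sigma>" for \<tau>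
  proof (cases "\<tau> 0 = k")
    case True
    then show ?thesis using less[of \<tau>] \<tau> \<sigma>(1) by (simp add: minor_perms_def)
  next
    case False
    have "\<tau> 0 \<le> d" using permutes_in_image[OF \<tau>(1), of 0] by simp
    moreover have "minor_tdet d \<pi> (\<tau> 0) \<le> minor_cost d \<pi> \<tau>"
      using \<tau>(1) by (intro minor_tdet_le) (simp add: minor_perms_def)
    ultimately show ?thesis using min[of "\<tau> 0"] False eq \<sigma>(1) by (simp add: minor_perms_def)
  qed
  then show ?L
    unfolding tsgn_eq_1_iff perm_weight_first_row using \<sigma> by (auto simp: minor_perms_def)
qed

lemma not_all_minors_positive:
  assumes "d \<ge> 1"
  shows "positive_minors d \<pi> \<noteq> {..d}"
proof
  assume all: "positive_minors d \<pi> = {..d}"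
  \<comment> \<open>The weight of \<open>\<sigma>\<close> when row \<open>0\<close> is a copy of row
    \<open>1\<close>.\<close>
  define w where "w \<sigma> = \<pi> 1 (\<sigma> 0) + minor_cost d \<pi> \<sigma>" for \<sigma>
  \<comment> \<open>A global minimizer of \<open>w\<close> also minimizes \<open>minor_cost\<close>
    in its class, so it is the strict minimizer there, which is even by assumption.\<close>
  have even: "sign \<sigma> = 1"
    if \<sigma>: "\<sigma> permutes {..d}" and min: "\<And>\<tau>. \<tau> permutes {..d} \<Longrightarrow> w \<sigma> \<le> w \<tau>" for \<sigma>
  proof -
    have "\<sigma> 0 \<in> positive_minors d \<pi>" using permutes_in_image[OF \<sigma>, of 0] all by simp
    then obtain \<rho> where \<rho>: "\<rho> \<in> minor_perms d (\<sigma> 0)" "sign \<rho> = 1"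
      and less: "\<And>\<tau>. \<tau> \<in> minor_perms d (\<sigma> 0) \<Longrightarrow> \<tau> \<noteq> \<rho> \<Longrightarrow> minor_cost d \<pi> \<rho> < minor_cost d \<pi> \<tau>"
      unfolding positive_minors_def by blast
    have "\<not> minor_cost d \<pi> \<rho> < minor_cost d \<pi> \<sigma>"
      using min[of \<rho>] \<rho>(1) by (simp add: w_def minor_perms_def)
    then have "\<sigma> = \<rho>" using less[of \<sigma>] \<sigma> by (auto simp: minor_perms_def)
    then show ?thesis using \<rho>(2) by simp
  qed
  let ?T = "transpose (0::nat) 1"
  have T: "?T permutes {..d}" using assms by (intro permutes_swap_id) auto
  \<comment> \<open>The transposition only exchanges the terms of the two equal rows.\<close>
  have wT: "w (\<sigma> \<circ> ?T) = w \<sigma>" for \<sigma>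
  proof -
    have "{1..d} = insert 1 {2..d}" using assms by auto
    then have split: "(\<Sum>i = 1..d. g i) = g 1 + (\<Sum>i = 2..d. g i)" for g :: "nat \<Rightarrow> real"
      by (simp del: One_nat_def)
    have "(\<Sum>i = 2..d. \<pi> i (\<sigma> (?T i))) = (\<Sum>i = 2..d. \<pi> i (\<sigma> i))"
      by (intro sum.cong) (auto simp: transpose_def)
    then show ?thesis unfolding w_def minor_cost_def split by simp
  qed
  have "finite {\<sigma>. \<sigma> permutes {..d}}" by (simp add: finite_permutations)
  moreover have "{\<sigma>. \<sigma> permutes {..d}} \<noteq> {}" using permutes_id by blast
  ultimately obtain \<sigma> where \<sigma>: "\<sigma> permutes {..d}" "\<And>\<tau>. \<tau> permutes {..d} \<Longrightarrow> w \<sigma> \<le> w \<tau>"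
    using arg_min_if_finite(1)[of "{\<sigma>. \<sigma> permutes {..d}}" w]
      arg_min_least[of "{\<sigma>. \<sigma> permutes {..d}}" _ w] by blast
  have "sign (\<sigma> \<circ> ?T) = 1"
    by (rule even) (use permutes_compose[OF T \<sigma>(1)] \<sigma>(2) wT in simp_all)
  moreover have "sign (\<sigma> \<circ> ?T) = - sign \<sigma>"
    using permutation_permutes[of \<sigma>] \<sigma>(1)
    by (subst sign_compose) (auto simp: sign_swap_id permutation_swap_id)
  moreover have "sign \<sigma> = 1" using \<sigma> by (rule even)
  ultimately show False by simp
qed

section \<open>Sectors in the tropical projective torus\<close>

text \<open>Restriction makes the vector extensional, so that points can be given by total
  functions.\<close>

definition tp_class :: "nat \<Rightarrow> (nat \<Rightarrow> real) \<Rightarrow> tp_point" where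
  "tp_class d v = tp_rel d `` {restrict v {..d}}"

lemma tp_class_in_TP: "tp_class d v \<in> TP d"
  unfolding tp_class_def TP_def by (intro quotientI) (auto simp: tp_vecs_def)

lemma restrict_in_tp_class: "restrict v {..d} \<in> tp_class d v"
  unfolding tp_class_def by (intro equiv_class_self[OF equiv_tp_rel]) (auto simp: tp_vecs_def)

lemma tp_rep_tp_class:
  obtains t where "\<And>i. i \<le> d \<Longrightarrow> tp_rep (tp_class d v) i = v i + t"
proof -
  obtain t where "\<And>i. i \<le> d \<Longrightarrow> tp_rep (tp_class d v) i = restrict v {..d} i + t"
    using tp_rep_shift[OF tp_class_in_TP restrict_in_tp_class] by blast
  then show ?thesis using that by simp
qed

lemma tp_class_eqI:
  assumes "X \<in> TP d" "\<And>i. i \<le> d \<Longrightarrow> v i = tp_rep X i + t"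
  shows "tp_class d v = X"
proof -
  have "tp_rep X \<in> X" using assms(1) by (rule tp_rep_in)
  moreover have "tp_rep X \<in> tp_vecs d"
    using in_quotient_imp_subset[OF equiv_tp_rel] assms(1) calculation unfolding TP_def by blast
  then have "(tp_rep X, restrict v {..d}) \<in> tp_rel d"
    using assms(2) by (auto simp: tp_rel_def tp_vecs_def)
  moreover have "restrict v {..d} \<in> tp_class d v" by (rule restrict_in_tp_class)
  ultimately show ?thesis
    using quotient_eq_iff[OF equiv_tp_rel, of X d "tp_class d v" "tp_rep X" "restrict v {..d}"]
      assms(1) tp_class_in_TP[of d v] by (simp add: TP_def)
qed

lemma open_sector_iff:
  assumes "c \<in> TP d" and k: "k \<le> d"
  shows "X \<in> open_sector d c k \<longleftrightarrow> X \<in> TP d \<and>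
     (\<forall>j\<le>d. j \<noteq> k \<longrightarrow> tp_rep X k - tp_rep c k < tp_rep X j - tp_rep c j)"
proof
  assume "X \<in> open_sector d c k"
  then obtain Y where Y: "Y \<in> S_sector d k" and X: "X = tp_add d c Y"
    by (auto simp: open_sector_def)
  have X': "X = tp_class d (\<lambda>i. tp_rep c i + tp_rep Y i)"
    by (simp add: X tp_add_def tp_class_def)
  obtain t where "\<And>i. i \<le> d \<Longrightarrow> tp_rep X i = tp_rep c i + tp_rep Y i + t"
    using tp_rep_tp_class unfolding X' by blast
  then show "X \<in> TP d \<and>
      (\<forall>j\<le>d. j \<noteq> k \<longrightarrow> tp_rep X k - tp_rep c k < tp_rep X j - tp_rep c j)"
    using Y k tp_class_in_TP X' by (auto simp: S_sector_def)
next
  assume X: "X \<in> TP d \<and>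
      (\<forall>j\<le>d. j \<noteq> k \<longrightarrow> tp_rep X k - tp_rep c k < tp_rep X j - tp_rep c j)"
  define Y where "Y = tp_class d (\<lambda>i. tp_rep X i - tp_rep c i)"
  obtain t where t: "\<And>i. i \<le> d \<Longrightarrow> tp_rep Y i = tp_rep X i - tp_rep c i + t"
    using tp_rep_tp_class unfolding Y_def by blast
  have "Y \<in> S_sector d k"
    using X k t tp_class_in_TP by (auto simp: S_sector_def Y_def)
  moreover have "tp_add d c Y = tp_class d (\<lambda>i. tp_rep c i + tp_rep Y i)"
    by (simp add: tp_add_def tp_class_def)
  then have "tp_add d c Y = X" using X t by (simp add: tp_class_eqI)
  ultimately show "X \<in> open_sector d c k" by (auto simp: open_sector_def)
qed

text \<open>Needed because \<open>open_sectors\<close> ranges over every apex of a hyperplane. If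
  the difference of two apices is not constant, a point is built that lies on one hyperplane but not
  on the other.\<close>

lemma trop_hyperplane_inject:
  assumes "c \<in> TP d" "c' \<in> TP d" "trop_hyperplane d c = trop_hyperplane d c'"
  shows "c = c'"
proof (rule ccontr)
  assume "c \<noteq> c'"
  define \<delta> where "\<delta> i = tp_rep c i - tp_rep c' i" for i
  obtain i where i: "i \<le> d" "\<And>j. j \<le> d \<Longrightarrow> \<delta> i \<le> \<delta> j"
    using arg_min_if_finite(1)[of "{..d}" \<delta>] arg_min_least[of "{..d}" _ \<delta>] by auto
  obtain j where j: "j \<le> d" "\<delta> i < \<delta> j"
  proof (rule ccontr)
    assume "\<not> thesis"
    then have "\<And>j. j \<le> d \<Longrightarrow> \<delta> j = \<delta> i" using that i(2) order_le_less by metis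
    then have "\<And>j. j \<le> d \<Longrightarrow> tp_rep c j = tp_rep c' j + \<delta> i" by (force simp: \<delta>_def)
    then have "tp_class d (tp_rep c) = c'" by (rule tp_class_eqI[OF assms(2)])
    moreover have "tp_class d (tp_rep c) = c"
      by (rule tp_class_eqI[OF assms(1), where t = 0]) simp
    ultimately show False using \<open>c \<noteq> c'\<close> by simp
  qed
  \<comment> \<open>Seen from \<open>c\<close>, the point \<open>c + y\<close> has its minimum at
    both \<open>i\<close> and \<open>j\<close>. Seen from \<open>c'\<close>, the values are
    \<open>y + \<delta>\<close>, minimal at \<open>i\<close> alone: \<open>\<delta>\<close> is
    larger at \<open>j\<close>, and \<open>y\<close> adds 1 elsewhere.\<close>
  define y :: "nat \<Rightarrow> real" where "y l = (if l = i \<or> l = j then 0 else 1)" for l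
  define X where "X = tp_class d (\<lambda>l. tp_rep c l + y l)"
  have X: "X \<in> TP d" by (simp add: X_def tp_class_in_TP)
  obtain t where t: "\<And>l. l \<le> d \<Longrightarrow> tp_rep X l = tp_rep c l + y l + t"
    using tp_rep_tp_class unfolding X_def by blast
  have "i \<noteq> j" using j(2) by blast
  moreover have "tp_rep X i - tp_rep c i = tp_rep X j - tp_rep c j"
    "\<forall>l\<le>d. tp_rep X i - tp_rep c i \<le> tp_rep X l - tp_rep c l"
    using i(1) j(1) t by (auto simp: y_def)
  ultimately have "X \<in> trop_hyperplane d c"
    unfolding trop_hyperplane_def min_attained_twice_iff using X i(1) j(1) by blast
  moreover have "X \<notin> trop_hyperplane d c'"
  proof
    assume "X \<in> trop_hyperplane d c'"
    then obtain m n where mn: "m \<le> d" "n \<le> d" "m \<noteq> n"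
      and eq: "tp_rep X m - tp_rep c' m = tp_rep X n - tp_rep c' n"
      and le: "tp_rep X m - tp_rep c' m \<le> tp_rep X i - tp_rep c' i"
      unfolding trop_hyperplane_def min_attained_twice_iff using i(1) by blast
    have X\<delta>: "tp_rep X l - tp_rep c' l = y l + \<delta> l + t" if "l \<le> d" for l
      using t[OF that] by (simp add: \<delta>_def)
    have "l = i" if l: "l \<le> d" "y l + \<delta> l \<le> \<delta> i" for l
      using l i(2)[of l] j(2) by (auto simp: y_def split: if_splits)
    moreover have "y i = 0" by (simp add: y_def)
    ultimately have "m = i" "n = i" using mn eq le i(1) by (auto simp: X\<delta>)
    then show False using mn(3) by simp
  qed
  ultimately show False using assms(3) by simp
qed

lemma open_sectors_trop_hyperplane:
  assumes "c \<in> TP d"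
  shows "open_sectors d (trop_hyperplane d c) = open_sector d c ` {..d}"
  using trop_hyperplane_inject[OF assms] assms by (auto simp: open_sectors_def)

text \<open>The inequalities of \<open>tsgn_first_row_eq_1_iff\<close> compare the coordinates of
  \<open>X\<close> minus those of the apex \<open>- minor_tdet\<close>. Arbitrary representatives
  \<open>\<pi>\<close> are allowed, to fit both given points and a constructed matrix.\<close>

lemma tau_eq_1_set:
  assumes "\<And>i. i \<in> {1..d} \<Longrightarrow> p i \<in> TP d \<and> \<pi> i \<in> p i"
  shows "{X \<in> TP d. tau d p X = 1} =
     (\<Union>k\<in>positive_minors d \<pi>. open_sector d (tp_class d (\<lambda>k. - minor_tdet d \<pi> k)) k)"
proof -
  let ?c = "tp_class d (\<lambda>k. - minor_tdet d \<pi> k)"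
  obtain t where t: "\<And>i. i \<le> d \<Longrightarrow> tp_rep ?c i = - minor_tdet d \<pi> i + t"
    using tp_rep_tp_class by blast
  have le: "\<And>k. k \<in> positive_minors d \<pi> \<Longrightarrow> k \<le> d" by (simp add: positive_minors_def)
  have "tau d p X = 1 \<longleftrightarrow> (\<exists>k\<in>positive_minors d \<pi>. X \<in> open_sector d ?c k)"
    if X: "X \<in> TP d" for X
  proof -
    have "tau d p X = tsgn d (\<lambda>i. if i = 0 then tp_rep X else \<pi> i)"
      using assms X by (intro tau_eq tp_rep_in) auto
    then show ?thesis
      using X le
      by (simp add: tsgn_first_row_eq_1_iff open_sector_iff[OF tp_class_in_TP] t algebra_simps cong: bex_cong)
  qed
  moreover have "X \<in> TP d" if "X \<in> open_sector d ?c k" "k \<in> positive_minors d \<pi>" for X k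
    using that le open_sector_iff[OF tp_class_in_TP] by blast
  ultimately show ?thesis by blast
qed

section \<open>Points realizing a union of sectors\<close>

text \<open>
  The tree is a double star with centres \<open>a \<in> K\<close> and \<open>b \<notin> K\<close>, and \<open>double_star_perm K a b k\<close>
  turns the tree from the root \<open>b\<close> to the root \<open>k\<close>.
\<close>

definition double_star_parent :: "nat set \<Rightarrow> nat \<Rightarrow> nat \<Rightarrow> nat \<Rightarrow> nat" where
  "double_star_parent K a b v = (if v \<in> K then b else a)"

definition double_star_perm :: "nat set \<Rightarrow> nat \<Rightarrow> nat \<Rightarrow> nat \<Rightarrow> nat \<Rightarrow> nat" where
  "double_star_perm K a b k = (if k = b then id else if k \<in> K then transpose b k
     else transpose a b \<circ> transpose b k)"

context
  fixes K :: "nat set" and a b d :: nat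
  assumes a: "a \<in> K" and K: "K \<subseteq> {..d}" and b: "b \<notin> K" "b \<le> d"
begin

lemma double_star_perm_permutes:
  assumes "k \<le> d"
  shows "double_star_perm K a b k permutes {..d}"
  using assms a K b unfolding double_star_perm_def
  by (auto intro!: permutes_compose permutes_swap_id permutes_id)

lemma double_star_perm_root: "double_star_perm K a b k b = k"
  using a b by (auto simp: double_star_perm_def transpose_def)

text \<open>Rooted at \<open>b\<close>, the tree has one edge for each \<open>v \<noteq> b\<close>,
  leading to its parent, so these \<open>v\<close> index the edges and each edge is sent to one of
  its ends.\<close>

lemma double_star_perm_edge:
  assumes "v \<noteq> b"
  shows "double_star_perm K a b k v = v \<or>
     double_star_perm K a b k v = double_star_parent K a b v"
  using assms a b by (auto simp: double_star_perm_def double_star_parent_def transpose_def)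

text \<open>The number of transpositions is the distance from \<open>b\<close> to \<open>k\<close>,
  and each edge crosses between \<open>K\<close> and its complement.\<close>

lemma sign_double_star_perm: "sign (double_star_perm K a b k) = (if k \<in> K then -1 else 1)"
  using a b
  by (auto simp: double_star_perm_def sign_compose permutation_swap_id sign_swap_id)

text \<open>Injectivity forces the orientation. The vertex \<open>\<rho> b\<close> is already taken,
  so its edge goes to its parent, whose own edge must then move on, until \<open>b\<close> is
  reached. Off this path, first \<open>b\<close> and then \<open>a\<close> is taken, so every edge
  stays at its own vertex.\<close>

lemma double_star_perm_unique:
  assumes \<rho>: "\<rho> permutes {..d}"
    and edge: "\<And>v. v \<le> d \<Longrightarrow> v \<noteq> b \<Longrightarrow> \<rho> v = v \<or> \<rho> v = double_star_parent K a b v"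
  shows "\<rho> = double_star_perm K a b (\<rho> b)"
proof
  fix v
  have inj: "\<And>x y. \<rho> x = \<rho> y \<longleftrightarrow> x = y" using permutes_inj[OF \<rho>] by (simp add: inj_eq)
  have inK: "\<And>v. v \<in> K \<Longrightarrow> \<rho> v = v \<or> \<rho> v = b"
    using edge K b by (fastforce simp: double_star_parent_def)
  have notK: "\<And>v. v \<le> d \<Longrightarrow> v \<notin> K \<Longrightarrow> v \<noteq> b \<Longrightarrow> \<rho> v = v \<or> \<rho> v = a"
    using edge by (fastforce simp: double_star_parent_def)
  have out: "\<And>v. \<not> v \<le> d \<Longrightarrow> \<rho> v = v" using permutes_not_in[OF \<rho>] by simp
  have kd: "\<rho> b \<le> d" using permutes_in_image[OF \<rho>, of b] b by simp
  \<comment> \<open>The distance from \<open>b\<close> to the root is 0, 1 or 2.\<close>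
  consider "\<rho> b = b" | "\<rho> b \<noteq> b" "\<rho> b \<in> K" | "\<rho> b \<noteq> b" "\<rho> b \<notin> K" by blast
  then show "\<rho> v = double_star_perm K a b (\<rho> b) v"
  proof cases
    case 1
    have fixK: "\<And>v. v \<in> K \<Longrightarrow> \<rho> v = v" using inK inj 1 b by metis
    then have "\<rho> v = v" using notK out inj 1 a by metis
    then show ?thesis by (simp add: double_star_perm_def 1)
  next
    case 2
    have k: "\<rho> (\<rho> b) = b" using inK[of "\<rho> b"] 2 inj by metis
    have fixK: "\<And>v. v \<in> K \<Longrightarrow> v \<noteq> \<rho> b \<Longrightarrow> \<rho> v = v" using inK inj k by metis
    have "\<rho> v = v" if "v \<noteq> b" "v \<noteq> \<rho> b"
      using that fixK notK[of v] out a inj by metis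
    then show ?thesis using k 2 by (auto simp: double_star_perm_def transpose_def)
  next
    case 3
    have k: "\<rho> (\<rho> b) = a" using notK[of "\<rho> b"] 3 inj kd by metis
    have ka: "\<rho> a = b" using inK[OF a] k 3 inj a by metis
    have fixK: "\<And>v. v \<in> K \<Longrightarrow> v \<noteq> a \<Longrightarrow> \<rho> v = v" using inK inj ka by metis
    have "\<rho> v = v" if "v \<noteq> b" "v \<noteq> \<rho> b" "v \<noteq> a"
      using that fixK notK[of v] out a inj k by metis
    then show ?thesis using k ka 3 a b by (auto simp: double_star_perm_def transpose_def)
  qed
qed

end

text \<open>Serves to attach rows to edges: row \<open>i\<close> becomes the edge indexed by
  \<open>\<beta> i\<close>, and row \<open>0\<close> takes the leftover \<open>b\<close>. The odd
  sign cancels the -1 of \<open>double_star_perm\<close> on \<open>K\<close>.\<close>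

lemma ex_odd_perm:
  fixes d b :: nat
  assumes "d \<ge> 2" "b \<le> d"
  obtains \<beta> where "\<beta> permutes {..d}" "\<beta> 0 = b" "sign \<beta> = -1"
proof (cases "b = 0")
  case True
  \<comment> \<open>An odd permutation fixing \<open>0\<close> moves at least two other indices,
    whence \<open>d \<ge> 2\<close>.\<close>
  have "transpose 1 2 permutes {..d}" using assms by (intro permutes_swap_id) auto
  then show ?thesis using that[of "transpose 1 2"] True by (simp add: sign_swap_id transpose_def)
next
  case False
  have "transpose 0 b permutes {..d}" using assms by (intro permutes_swap_id) auto
  then show ?thesis using that[of "transpose 0 b"] False by (simp add: sign_swap_id)
qed

text \<open>Here \<open>\<gamma>\<close> is the prescribed apex. Adding \<open>\<gamma> j\<close> to
  column \<open>j\<close> adds the total of \<open>\<gamma>\<close> minus \<open>\<gamma> k\<close>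
  to every matching that omits \<open>k\<close>, so it moves the apex and preserves the optimal
  matchings.\<close>

lemma ex_matrix_positive_minors:
  assumes "d \<ge> 2" "K \<subseteq> {..d}" "K \<noteq> {}" "K \<noteq> {..d}"
  obtains \<pi> s where "positive_minors d \<pi> = K"
    "\<And>k. k \<le> d \<Longrightarrow> minor_tdet d \<pi> k = s - \<gamma> k"
proof -
  obtain a b where ab: "a \<in> K" "b \<notin> K" "b \<le> d" using assms by blast
  obtain \<beta> where \<beta>: "\<beta> permutes {..d}" "\<beta> 0 = b" "sign \<beta> = -1"
    using ex_odd_perm[OF assms(1) ab(3)] by blast
  note star = ab(1) assms(2) ab(2,3)
  let ?ds = "double_star_perm K a b" and ?f = "double_star_parent K a b"
  define q :: "nat \<Rightarrow> nat \<Rightarrow> real"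
    where "q i j = (if j = \<beta> i \<or> j = ?f (\<beta> i) then 0 else 1)" for i j
  define \<pi> where "\<pi> i j = \<gamma> j + q i j" for i j
  define s where "s = sum \<gamma> {..d}"
  have cost: "minor_cost d \<pi> \<sigma> = s - \<gamma> k + minor_cost d q \<sigma>" if "\<sigma> \<in> minor_perms d k" for \<sigma> k
  proof -
    have \<sigma>: "\<sigma> permutes {..d}" "\<sigma> 0 = k" using that by (auto simp: minor_perms_def)
    have "s = (\<Sum>i\<le>d. \<gamma> (\<sigma> i))" using sum.permute[OF \<sigma>(1), of \<gamma>] by (simp add: s_def comp_def)
    also have "{..d} = insert 0 {1..d}" by auto
    finally show ?thesis by (simp add: minor_cost_def \<pi>_def sum.distrib \<sigma>(2))
  qed
  have q_nonneg: "minor_cost d q \<sigma> \<ge> 0" for \<sigma>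
    unfolding minor_cost_def by (intro sum_nonneg) (simp add: q_def)
  have q_zero: "minor_cost d q \<sigma> = 0 \<longleftrightarrow> (\<forall>i\<in>{1..d}. \<sigma> i = \<beta> i \<or> \<sigma> i = ?f (\<beta> i))" for \<sigma>
    unfolding minor_cost_def by (subst sum_nonneg_eq_0_iff) (auto simp: q_def)
  have \<beta>_row: "\<beta> i \<noteq> b" if "i \<in> {1..d}" for i
    using that \<beta>(2) permutes_inj[OF \<beta>(1)] by (metis atLeastAtMost_iff injD not_one_le_zero)
  have opt: "?ds k \<circ> \<beta> \<in> minor_perms d k" "minor_cost d q (?ds k \<circ> \<beta>) = 0" if "k \<le> d" for k
  proof -
    show "?ds k \<circ> \<beta> \<in> minor_perms d k"
      using double_star_perm_permutes[OF star that] double_star_perm_root[OF star] \<beta>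
      by (auto simp: minor_perms_def intro: permutes_compose)
    show "minor_cost d q (?ds k \<circ> \<beta>) = 0"
      using double_star_perm_edge[OF star] \<beta>_row by (simp add: q_zero)
  qed
  \<comment> \<open>Composing with \<open>inv \<beta>\<close> indexes the edges by vertices again.
    Zero cost says that each edge is sent to one of its ends, and the root is \<open>k\<close>
    because \<open>inv \<beta> b = 0\<close>.\<close>
  have uniq: "\<sigma> = ?ds k \<circ> \<beta>" if "\<sigma> \<in> minor_perms d k" "minor_cost d q \<sigma> = 0" for \<sigma> k
  proof -
    have \<sigma>: "\<sigma> permutes {..d}" "\<sigma> 0 = k" using that by (auto simp: minor_perms_def)
    have inv: "inv \<beta> permutes {..d}" using \<beta>(1) by (rule permutes_inv)
    have "\<sigma> \<circ> inv \<beta> = ?ds ((\<sigma> \<circ> inv \<beta>) b)"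
    proof (rule double_star_perm_unique[OF star])
      show "\<sigma> \<circ> inv \<beta> permutes {..d}" using inv \<sigma>(1) by (rule permutes_compose)
      fix v assume v: "v \<le> d" "v \<noteq> b"
      have "inv \<beta> v \<le> d" using permutes_in_image[OF inv, of v] v(1) by simp
      moreover have "\<beta> (inv \<beta> v) = v" using permutes_inverses(1)[OF \<beta>(1)] .
      moreover have "inv \<beta> v \<noteq> 0" using calculation(2) v(2) \<beta>(2) by metis
      ultimately show "(\<sigma> \<circ> inv \<beta>) v = v \<or> (\<sigma> \<circ> inv \<beta>) v = ?f v"
        using that(2)[unfolded q_zero, rule_format, of "inv \<beta> v"] by simp
    qed
    moreover have "inv \<beta> b = 0" using permutes_inverses(2)[OF \<beta>(1), of 0] \<beta>(2) by simp
    ultimately have "\<sigma> \<circ> inv \<beta> \<circ> \<beta> = ?ds k \<circ> \<beta>" using \<sigma>(2) by simp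
    then show ?thesis using permutes_inv_o(2)[OF \<beta>(1)] by (simp add: o_assoc[symmetric])
  qed
  have sign_opt: "sign (?ds k \<circ> \<beta>) = (if k \<in> K then 1 else -1)" if "k \<le> d" for k
  proof -
    have "permutation (?ds k)" "permutation \<beta>"
      using double_star_perm_permutes[OF star that] \<beta>(1) by (auto simp: permutation_permutes)
    then show ?thesis by (simp add: sign_compose sign_double_star_perm[OF star] \<beta>(3))
  qed
  have strict: "minor_cost d \<pi> (?ds k \<circ> \<beta>) < minor_cost d \<pi> \<sigma>"
    if "k \<le> d" "\<sigma> \<in> minor_perms d k" "\<sigma> \<noteq> ?ds k \<circ> \<beta>" for k \<sigma>
    using uniq[OF that(2)] that q_nonneg[of \<sigma>] opt[OF that(1)] by (force simp: cost)
  have "positive_minors d \<pi> = K"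
  proof (intro equalityI subsetI)
    fix k assume "k \<in> positive_minors d \<pi>"
    then obtain \<sigma> where k: "k \<le> d" and \<sigma>: "\<sigma> \<in> minor_perms d k" "sign \<sigma> = 1"
      "\<And>\<tau>. \<tau> \<in> minor_perms d k \<Longrightarrow> \<tau> \<noteq> \<sigma> \<Longrightarrow> minor_cost d \<pi> \<sigma> < minor_cost d \<pi> \<tau>"
      by (auto simp: positive_minors_def)
    \<comment> \<open>Two distinct strict minimizers would each be cheaper than the other.\<close>
    have "\<sigma> = ?ds k \<circ> \<beta>" using strict[OF k \<sigma>(1)] \<sigma>(3) opt(1)[OF k] by force
    then show "k \<in> K" using \<sigma>(2) sign_opt[OF k] by (auto split: if_splits)
  next
    fix k assume "k \<in> K"
    then show "k \<in> positive_minors d \<pi>"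
      unfolding positive_minors_def using assms(2) opt(1) sign_opt strict
      by (auto intro!: bexI[of _ "?ds k \<circ> \<beta>"])
  qed
  moreover have "minor_tdet d \<pi> k = s - \<gamma> k" if k: "k \<le> d" for k
  proof -
    obtain \<sigma> where \<sigma>: "\<sigma> \<in> minor_perms d k" "minor_cost d \<pi> \<sigma> = minor_tdet d \<pi> k"
      using minor_tdet_attained[OF k] by blast
    have "minor_tdet d \<pi> k \<le> s - \<gamma> k"
      using minor_tdet_le[OF opt(1)[OF k], of \<pi>] opt[OF k] by (simp add: cost)
    then show ?thesis using \<sigma> q_nonneg[of \<sigma>] by (simp add: cost)
  qed
  ultimately show ?thesis using that by blast
qed

theorem theorem4p7:
  fixes d :: nat
  assumes "d \<ge> 2"
  shows "(\<forall>p. (\<forall>i\<in>{1..d}. p i \<in> TP d) \<longrightarrow>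
            {X \<in> TP d. tau d p X = 1} = {} \<or>
            (\<exists>H \<in> trop_hyperplanes d. \<exists>\<S>. \<S> \<subseteq> open_sectors d H \<and> finite \<S> \<and> card \<S> \<le> d \<and>
               {X \<in> TP d. tau d p X = 1} = \<Union>\<S>))
       \<and> (\<forall>H \<in> trop_hyperplanes d. \<forall>\<S>.
            \<S> \<subseteq> open_sectors d H \<and> finite \<S> \<and> 1 \<le> card \<S> \<and> card \<S> \<le> d \<longrightarrow>
            (\<exists>p. (\<forall>i\<in>{1..d}. p i \<in> TP d) \<and> {X \<in> TP d. tau d p X = 1} = \<Union>\<S>))"
proof (intro conjI allI impI ballI)
  fix p assume p: "\<forall>i\<in>{1..d}. p i \<in> TP d"
  let ?\<pi> = "\<lambda>i. tp_rep (p i)"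
  let ?c = "tp_class d (\<lambda>k. - minor_tdet d ?\<pi> k)"
  let ?E = "positive_minors d ?\<pi>"
  have eq: "{X \<in> TP d. tau d p X = 1} = \<Union>(open_sector d ?c ` ?E)"
    by (rule tau_eq_1_set) (use p in \<open>auto intro: tp_rep_in\<close>)
  have E: "?E \<subset> {..d}"
    using not_all_minors_positive[of d ?\<pi>] assms by (auto simp: positive_minors_def)
  have fin: "finite ?E" using E finite_subset by blast
  have "card (open_sector d ?c ` ?E) \<le> d"
    using card_image_le[OF fin, of "open_sector d ?c"] psubset_card_mono[OF _ E] by simp
  moreover have "open_sector d ?c ` ?E \<subseteq> open_sectors d (trop_hyperplane d ?c)"
    using E by (auto simp: open_sectors_trop_hyperplane[OF tp_class_in_TP])
  moreover have "trop_hyperplane d ?c \<in> trop_hyperplanes d"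
    by (simp add: trop_hyperplanes_def tp_class_in_TP)
  ultimately show "{X \<in> TP d. tau d p X = 1} = {} \<or>
      (\<exists>H \<in> trop_hyperplanes d. \<exists>\<S>. \<S> \<subseteq> open_sectors d H \<and> finite \<S> \<and> card \<S> \<le> d \<and>
         {X \<in> TP d. tau d p X = 1} = \<Union>\<S>)"
    using eq fin by blast
next
  fix H \<S>
  assume "H \<in> trop_hyperplanes d" and
    \<S>: "\<S> \<subseteq> open_sectors d H \<and> finite \<S> \<and> 1 \<le> card \<S> \<and> card \<S> \<le> d"
  then obtain c where c: "c \<in> TP d" and H: "H = trop_hyperplane d c"
    by (auto simp: trop_hyperplanes_def)
  have "\<S> \<subseteq> open_sector d c ` {..d}" using \<S> open_sectors_trop_hyperplane[OF c] H by simp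
  \<comment> \<open>\<open>K\<close> is chosen with \<open>open_sector d c\<close> injective on it,
    so it has as many elements as \<open>\<S>\<close>, hence at most \<open>d\<close>, and misses an
    index.\<close>
  then obtain K where K: "K \<subseteq> {..d}" "inj_on (open_sector d c) K" "\<S> = open_sector d c ` K"
    by (auto simp: subset_image_inj)
  have "1 \<le> card K" "card K \<le> d" using \<S> K card_image by fastforce+
  then have "K \<noteq> {}" "K \<noteq> {..d}" by auto
  then obtain \<pi> s where \<pi>: "positive_minors d \<pi> = K"
    "\<And>k. k \<le> d \<Longrightarrow> minor_tdet d \<pi> k = s - tp_rep c k"
    using ex_matrix_positive_minors[OF assms K(1)] by metis
  define p where "p i = tp_class d (\<pi> i)" for i
  \<comment> \<open>The points \<open>p i\<close> contain the restricted rows. Minors read only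
    columns in \<open>{..d}\<close>, so they are unchanged.\<close>
  have minor: "minor_cost d (\<lambda>i. restrict (\<pi> i) {..d}) \<sigma> = minor_cost d \<pi> \<sigma>"
    if "\<sigma> \<in> minor_perms d k" for \<sigma> k
    unfolding minor_cost_def using that permutes_in_image[of \<sigma> "{..d}"]
    by (intro sum.cong) (auto simp: minor_perms_def)
  have pos: "positive_minors d (\<lambda>i. restrict (\<pi> i) {..d}) = K"
    unfolding \<pi>(1)[symmetric] positive_minors_def by (simp add: minor cong: bex_cong ball_cong)
  have det: "minor_tdet d (\<lambda>i. restrict (\<pi> i) {..d}) k = minor_tdet d \<pi> k" for k
    unfolding minor_tdet_def by (simp add: minor cong: image_cong)
  \<comment> \<open>The constant \<open>s\<close> vanishes in the quotient.\<close>
  have "tp_class d (\<lambda>k. - minor_tdet d \<pi> k) = c"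
    by (rule tp_class_eqI[OF c, where t = "- s"]) (simp add: \<pi>(2))
  moreover have "{X \<in> TP d. tau d p X = 1} = (\<Union>k\<in>positive_minors d (\<lambda>i. restrict (\<pi> i) {..d}).
      open_sector d (tp_class d (\<lambda>k. - minor_tdet d (\<lambda>i. restrict (\<pi> i) {..d}) k)) k)"
    by (rule tau_eq_1_set) (simp add: p_def tp_class_in_TP restrict_in_tp_class)
  ultimately have "{X \<in> TP d. tau d p X = 1} = \<Union>\<S>" by (simp add: pos det K(3))
  then show "\<exists>p. (\<forall>i\<in>{1..d}. p i \<in> TP d) \<and> {X \<in> TP d. tau d p X = 1} = \<Union>\<S>"
    using tp_class_in_TP by (auto simp: p_def intro!: exI[of _ p])
qed

end
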